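(* Let $D$ be a strongly connected oriented graph. Then the following two conditions are equivalent: (1) for every vertex $x$, the out-neighbourhood $x^+$ induces a tournament and the in-neighbourhood $x^-$ induces an acyclic digraph; (2) there exists a cyclic order of the vertices of $D$ such that for every arc $xy\in A(D)$ and every vertex $z\in\, ]x,y[$, we have $zy\in A(D)$.
   Context: An oriented graph is a digraph with no loops, no parallel arcs and no pair of opposite arcs. $x^+$ and $x^-$ denote the sets of out-neighbours and in-neighbours of $x$. A cyclic order of $V(D)$ is an ordering $v_1,\dots,v_n$ considered up to cyclic rotation. For vertices $v_i\neq v_j$, the open cyclic interval $]v_i,v_j[$ is the set of vertices strictly between $v_i$ and $v_j$ when going forward cyclically from $v_i$ to $v_j$, i.e. $\{v_k: i<k<j\}$ if $i<j$ and $\{v_k: k>i \text{ or } k<j\}$ if $i>j$. *)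

theory Defs
  imports "Graph_Theory.Digraph_Component"
begin

text \<open>The locale \<open>digraph\<close> already gives finiteness, no loops and no parallel arcs.\<close>

locale oriented_graph = digraph +
  assumes no_opposite_arcs: "u \<rightarrow>\<^bsub>G\<^esub> v \<Longrightarrow> \<not> v \<rightarrow>\<^bsub>G\<^esub> u"

text \<open>Tournaments with no vertex are allowed: in the one-vertex digraph the out-neighbourhood
  is empty.\<close>

locale tournament = oriented_graph +
  assumes adjacent: "u \<in> verts G \<Longrightarrow> v \<in> verts G \<Longrightarrow> u \<noteq> v \<Longrightarrow> u \<rightarrow>\<^bsub>G\<^esub> v \<or> v \<rightarrow>\<^bsub>G\<^esub> u"

definition acyclic_digraph :: "('a, 'b) pre_digraph \<Rightarrow> bool" where
  "acyclic_digraph G \<longleftrightarrow> (\<nexists>p. pre_digraph.cycle G p)"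

definition out_neighbours :: "('a, 'b) pre_digraph \<Rightarrow> 'a \<Rightarrow> 'a set" where
  "out_neighbours G x = {y. x \<rightarrow>\<^bsub>G\<^esub> y}"

definition in_neighbours :: "('a, 'b) pre_digraph \<Rightarrow> 'a \<Rightarrow> 'a set" where
  "in_neighbours G x = {y. y \<rightarrow>\<^bsub>G\<^esub> x}"

text \<open>A cyclic order is represented by any of the lists \<open>v\<^sub>1, \<dots>, v\<^sub>n\<close> it is the
  rotation class of. Intervals depend only on that class, see
  \<open>open_cyclic_interval_rotate\<close> below.\<close>

definition vertex_ordering :: "('a, 'b) pre_digraph \<Rightarrow> 'a list \<Rightarrow> bool" where
  "vertex_ordering G vs \<longleftrightarrow> distinct vs \<and> set vs = verts G"

definition open_cyclic_interval :: "'a list \<Rightarrow> 'a \<Rightarrow> 'a \<Rightarrow> 'a set" where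
  "open_cyclic_interval vs x y =
    {vs ! k | i j k. i < length vs \<and> j < length vs \<and> k < length vs \<and> vs ! i = x \<and> vs ! j = y \<and>
      (i < j \<and> i < k \<and> k < j \<or> j < i \<and> (i < k \<or> k < j))}"

lemma vertex_ordering_rotate: "vertex_ordering G (rotate n vs) \<longleftrightarrow> vertex_ordering G vs"
  by (simp add: vertex_ordering_def)

lemma open_cyclic_interval_rotate1_subset:
  "open_cyclic_interval (rotate1 vs) x y \<subseteq> open_cyclic_interval vs x y"
proof
  fix z
  assume "z \<in> open_cyclic_interval (rotate1 vs) x y"
  then obtain i j k where len: "i < length vs" "j < length vs" "k < length vs"
    and xyz: "rotate1 vs ! i = x" "rotate1 vs ! j = y" "z = rotate1 vs ! k"
    and ord: "i < j \<and> i < k \<and> k < j \<or> j < i \<and> (i < k \<or> k < j)"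
    by (auto simp: open_cyclic_interval_def)
  define s where "s m = Suc m mod length vs" for m
  have s: "s m = (if Suc m = length vs then 0 else Suc m)" if "m < length vs" for m
    using that by (auto simp: s_def)
  have "vs ! s i = x" "vs ! s j = y" "z = vs ! s k"
    using xyz len by (simp_all add: nth_rotate1 s_def)
  moreover have "s i < length vs" "s j < length vs" "s k < length vs"
    using len by (auto simp: s)
  moreover have "s i < s j \<and> s i < s k \<and> s k < s j \<or> s j < s i \<and> (s i < s k \<or> s k < s j)"
    using ord len by (auto simp: s)
  ultimately show "z \<in> open_cyclic_interval vs x y"
    unfolding open_cyclic_interval_def by blast
qed

lemma open_cyclic_interval_rotate_subset:
  "open_cyclic_interval (rotate n vs) x y \<subseteq> open_cyclic_interval vs x y"
proof (induction n)
  case (Suc n)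
  then show ?case
    using open_cyclic_interval_rotate1_subset[of "rotate n vs" x y] by simp
qed simp

lemma open_cyclic_interval_rotate:
  "open_cyclic_interval (rotate n vs) x y = open_cyclic_interval vs x y"
proof
  let ?m = "length vs - n mod length vs"
  have "rotate ?m (rotate n vs) = vs"
  proof (cases "vs = []")
    case False
    then have "(?m + n) mod length vs = 0"
      by (metis add.commute length_greater_0_conv mod_add_left_eq mod_less_divisor
          mod_self le_add_diff_inverse less_imp_le)
    then show ?thesis
      by (simp add: rotate_rotate rotate_id)
  qed simp
  then show "open_cyclic_interval vs x y \<subseteq> open_cyclic_interval (rotate n vs) x y"
    using open_cyclic_interval_rotate_subset[of ?m "rotate n vs" x y] by simp
qed (rule open_cyclic_interval_rotate_subset)

end

theory Submission
  imports Defs "HOL-Combinatorics.Orbits"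
begin

text \<open>From (1) to (2): the in-neighbourhood of a vertex \<open>b\<close> is nonempty and acyclic, so it has a
  sink \<open>u\<close>. As \<open>u\<^sup>+\<close> is a tournament and no vertex of \<open>u\<^sup>+\<close> dominates \<open>b\<close>, the vertex \<open>b\<close>
  dominates the rest of \<open>u\<^sup>+\<close>. So \<open>b\<close> is determined by \<open>u\<close>, hence \<open>b \<mapsto> u\<close> is injective and
  therefore a permutation of the finite vertex set. Its inverse \<open>s\<close> satisfies \<open>x \<rightarrow> s x\<close>, and
  \<open>x \<rightarrow> y\<close> implies \<open>s x \<rightarrow> y\<close> unless \<open>s x = y\<close>. An arc leaving an orbit of \<open>s\<close> would place
  that orbit, which carries a closed walk, inside an in-neighbourhood. By strong connectivity \<open>s\<close>
  is then a single cycle, and it gives the cyclic order.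

  From (2) to (1): in the linear order that starts at \<open>x\<close>, all arcs within \<open>x\<^sup>+\<close> and within
  \<open>x\<^sup>-\<close> go forward.\<close>

section \<open>Acyclicity and induced subgraphs\<close>

text \<open>Every closed walk contains a cycle, and closed walks are the loops of the transitive
  closure. This gives access to the theory of acyclic relations.\<close>

lemma acyclic_digraph_iff:
  fixes G (structure)
  assumes "wf_digraph G"
  shows "acyclic_digraph G \<longleftrightarrow> acyclic (arcs_ends G)"
proof -
  interpret wf_digraph G by fact
  have "(\<exists>p. cycle p) \<longleftrightarrow> (\<exists>p. closed_w p)"
    using closed_w_imp_cycle by (auto simp: cycle_altdef)
  also have "\<dots> \<longleftrightarrow> (\<exists>u. u \<rightarrow>\<^sup>+ u)"
    by (auto simp: closed_w_def reachable1_awalk)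
  finally show ?thesis
    by (auto simp: acyclic_digraph_def acyclic_def)
qed

lemma dominates_induce_subgraph_iff:
  "u \<rightarrow>\<^bsub>G \<restriction> S\<^esub> v \<longleftrightarrow> u \<in> S \<and> v \<in> S \<and> u \<rightarrow>\<^bsub>G\<^esub> v"
  by (auto simp: arcs_ends_conv)

lemma oriented_graph_induce_subgraph:
  fixes G (structure)
  assumes "oriented_graph G" and "S \<subseteq> verts G"
  shows "oriented_graph (G \<restriction> S)"
proof -
  interpret oriented_graph G by fact
  interpret S: digraph "G \<restriction> S"
    using assms(2) by (intro digraphI_induced induced_induce)
  show ?thesis
    by unfold_locales (auto simp: dominates_induce_subgraph_iff dest: no_opposite_arcs)
qed

section \<open>Intervals and in-round orders\<close>

lemma open_cyclic_interval_nth: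
  assumes "distinct vs" "i < length vs" "j < length vs"
  shows "open_cyclic_interval vs (vs ! i) (vs ! j) =
    {vs ! k | k. k < length vs \<and> (i < j \<and> i < k \<and> k < j \<or> j < i \<and> (i < k \<or> k < j))}"
  unfolding open_cyclic_interval_def using assms
  by (auto simp: nth_eq_iff_index_eq)

text \<open>Intervals are invariant under rotation, so any chosen vertex may be put at position
  0.\<close>

lemma rotate_to_front:
  assumes "x \<in> set vs"
  obtains m where "rotate m vs ! 0 = x"
proof -
  obtain m where "m < length vs" "vs ! m = x"
    using assms by (auto simp: in_set_conv_nth)
  then have "rotate m vs ! 0 = x"
    by (cases "vs = []") (simp_all add: nth_rotate)
  then show thesis by (rule that)
qed

definition in_round :: "('a, 'b) pre_digraph \<Rightarrow> 'a list \<Rightarrow> bool" where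
  "in_round G vs \<longleftrightarrow> vertex_ordering G vs \<and>
    (\<forall>x y. x \<rightarrow>\<^bsub>G\<^esub> y \<longrightarrow> (\<forall>z\<in>open_cyclic_interval vs x y. z \<rightarrow>\<^bsub>G\<^esub> y))"

lemma in_round_rotate: "in_round G (rotate m vs) \<longleftrightarrow> in_round G vs"
  by (simp add: in_round_def vertex_ordering_rotate open_cyclic_interval_rotate)

lemma in_roundD:
  assumes "in_round G vs" "vs ! i \<rightarrow>\<^bsub>G\<^esub> vs ! j"
    and "i < length vs" "j < length vs" "k < length vs"
    and "i < j \<and> i < k \<and> k < j \<or> j < i \<and> (i < k \<or> k < j)"
  shows "vs ! k \<rightarrow>\<^bsub>G\<^esub> vs ! j"
  using assms unfolding in_round_def open_cyclic_interval_def by blast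

section \<open>From a cyclic order to neighbourhoods\<close>

lemma tournament_out_neighbours:
  fixes G (structure)
  assumes "oriented_graph G" "in_round G vs" "x \<in> verts G"
  shows "tournament (G \<restriction> out_neighbours G x)"
proof -
  interpret oriented_graph G by fact
  obtain m where m: "rotate m vs ! 0 = x"
    using assms(2,3) rotate_to_front[of x vs] by (auto simp: in_round_def vertex_ordering_def)
  define ws where "ws = rotate m vs"
  have ws: "in_round G ws" "ws ! 0 = x"
    using assms(2) m by (simp_all add: ws_def in_round_rotate)
  then have set_ws: "set ws = verts G"
    by (simp add: in_round_def vertex_ordering_def)
  have sub: "out_neighbours G x \<subseteq> verts G"
    by (auto simp: out_neighbours_def dest: adj_in_verts)
  \<comment> \<open>The arc from \<open>x\<close>, at position 0, to position \<open>j\<close> spans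
    position \<open>i\<close>.\<close>
  have fwd: "ws ! i \<rightarrow> ws ! j"
    if "x \<rightarrow> ws ! i" "x \<rightarrow> ws ! j" "i < j" "j < length ws" for i j
  proof -
    have "0 < i"
      using that(1) ws(2) by (cases i) (auto dest: adj_not_same)
    moreover have "0 < length ws"
      using that by linarith
    ultimately show ?thesis
      using in_roundD[OF ws(1), of 0 j i] that ws(2) by simp
  qed
  interpret S: oriented_graph "G \<restriction> out_neighbours G x"
    using assms(1) sub by (rule oriented_graph_induce_subgraph)
  show ?thesis
  proof (unfold_locales, goal_cases)
    case (1 u v)
    then have "x \<rightarrow> u" "x \<rightarrow> v"
      by (simp_all add: out_neighbours_def)
    moreover obtain i j where "i < length ws" "u = ws ! i" "j < length ws" "v = ws ! j"
      using 1 sub set_ws by (metis in_set_conv_nth induce_subgraph_verts subsetD)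
    ultimately show ?case
      using 1 fwd[of i j] fwd[of j i]
      by (cases i j rule: linorder_cases) (auto simp: dominates_induce_subgraph_iff)
  qed
qed

lemma acyclic_in_neighbours:
  fixes G (structure)
  assumes "oriented_graph G" "in_round G vs" "x \<in> verts G"
  shows "acyclic_digraph (G \<restriction> in_neighbours G x)"
proof -
  interpret oriented_graph G by fact
  obtain m where m: "rotate m vs ! 0 = x"
    using assms(2,3) rotate_to_front[of x vs] by (auto simp: in_round_def vertex_ordering_def)
  define ws where "ws = rotate m vs"
  have ws: "in_round G ws" "ws ! 0 = x"
    using assms(2) m by (simp_all add: ws_def in_round_rotate)
  then have set_ws: "set ws = verts G" and dist: "distinct ws"
    by (simp_all add: in_round_def vertex_ordering_def)
  define idx where "idx = inv_into {..<length ws} (nth ws)"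
  have idx: "idx (ws ! i) = i" if "i < length ws" for i
    unfolding idx_def using dist that by (intro inv_into_f_f) (auto intro: inj_on_nth)
  have "arcs_ends (G \<restriction> in_neighbours G x) \<subseteq> measure idx"
  proof clarify
    fix u v assume "u \<rightarrow>\<^bsub>G \<restriction> in_neighbours G x\<^esub> v"
    then have arcs: "u \<rightarrow> v" "v \<rightarrow> x"
      by (auto simp: dominates_induce_subgraph_iff in_neighbours_def)
    then obtain i j where ij: "i < length ws" "u = ws ! i" "j < length ws" "v = ws ! j"
      using set_ws by (metis adj_in_verts in_set_conv_nth)
    \<comment> \<open>Otherwise the interval from \<open>u\<close> forward to \<open>v\<close> wraps
      around through position 0, so \<open>x\<close> would dominate \<open>v\<close>, opposite to
      the arc from \<open>v\<close> to \<open>x\<close>.\<close>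
    have "i < j"
    proof (rule ccontr)
      assume "\<not> i < j"
      moreover have "i \<noteq> j" using arcs ij by (auto dest: adj_not_same)
      moreover have "0 < j"
        using arcs ij ws(2) by (cases j) (auto dest: adj_not_same)
      moreover have "0 < length ws"
        using ij by linarith
      ultimately have "x \<rightarrow> v"
        using in_roundD[OF ws(1), of i j 0] arcs ij ws(2) by simp
      then show False using arcs no_opposite_arcs by blast
    qed
    then show "(u, v) \<in> measure idx"
      using ij idx by simp
  qed
  then have "acyclic (arcs_ends (G \<restriction> in_neighbours G x))"
    by (rule acyclic_subset[OF wf_acyclic, rotated]) simp
  then show ?thesis
    by (simp add: acyclic_digraph_iff wellformed_induce_subgraph)
qed

section \<open>From neighbourhoods to a cyclic order\<close>

text \<open>The converse of a finite acyclic relation is well-founded, and the arc from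
  \<open>a\<close> makes the in-neighbourhood nonempty, so a minimal element exists.\<close>

lemma ex_in_neighbours_sink:
  fixes G (structure)
  assumes "fin_digraph G" "acyclic_digraph (G \<restriction> in_neighbours G b)" "a \<rightarrow>\<^bsub>G\<^esub> b"
  obtains u where "u \<rightarrow>\<^bsub>G\<^esub> b" "\<And>w. u \<rightarrow>\<^bsub>G\<^esub> w \<Longrightarrow> \<not> w \<rightarrow>\<^bsub>G\<^esub> b"
proof -
  interpret fin_digraph G by fact
  let ?R = "arcs_ends (G \<restriction> in_neighbours G b)"
  have "acyclic ?R"
    using assms(2) by (simp add: acyclic_digraph_iff wellformed_induce_subgraph)
  moreover have "finite ?R"
    by (simp add: arcs_ends_conv)
  ultimately have "wf (?R\<inverse>)"
    by (simp add: finite_acyclic_wf_converse)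
  moreover have "a \<in> in_neighbours G b"
    using assms(3) by (simp add: in_neighbours_def)
  ultimately obtain u where "u \<in> in_neighbours G b"
    "\<And>w. (w, u) \<in> ?R\<inverse> \<Longrightarrow> w \<notin> in_neighbours G b"
    by (rule wfE_min) blast
  then show thesis
    by (intro that) (auto simp: dominates_induce_subgraph_iff in_neighbours_def)
qed

lemma ex_successor_permutation:
  fixes G (structure)
  assumes "oriented_graph G"
    and tour: "\<And>x. x \<in> verts G \<Longrightarrow> tournament (G \<restriction> out_neighbours G x)"
    and acyc: "\<And>x. x \<in> verts G \<Longrightarrow> acyclic_digraph (G \<restriction> in_neighbours G x)"
    and pred: "\<And>b. b \<in> verts G \<Longrightarrow> \<exists>a. a \<rightarrow>\<^bsub>G\<^esub> b"
  obtains s where "s permutes verts G" "\<And>x. x \<in> verts G \<Longrightarrow> x \<rightarrow>\<^bsub>G\<^esub> s x"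
    "\<And>x y. x \<rightarrow>\<^bsub>G\<^esub> y \<Longrightarrow> y \<noteq> s x \<Longrightarrow> s x \<rightarrow>\<^bsub>G\<^esub> y"
proof -
  interpret oriented_graph G by fact
  have "\<exists>u. u \<rightarrow> b \<and> (\<forall>w. u \<rightarrow> w \<longrightarrow> \<not> w \<rightarrow> b)" if "b \<in> verts G" for b
    using ex_in_neighbours_sink[OF fin_digraph_axioms acyc[OF that]] pred[OF that] by metis
  then obtain g where g: "\<And>b. b \<in> verts G \<Longrightarrow> g b \<rightarrow> b"
    and sink: "\<And>b w. b \<in> verts G \<Longrightarrow> g b \<rightarrow> w \<Longrightarrow> \<not> w \<rightarrow> b"
    by metis
  have source: "b \<rightarrow> w" if "b \<in> verts G" "g b \<rightarrow> w" "w \<noteq> b" for b w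
  proof -
    interpret T: tournament "G \<restriction> out_neighbours G (g b)"
      using g[OF that(1)] by (intro tour) (auto dest: adj_in_verts)
    show ?thesis
      using T.adjacent[of b w] g[OF that(1)] sink[OF that(1,2)] that
      by (auto simp: out_neighbours_def dominates_induce_subgraph_iff)
  qed
  \<comment> \<open>Two vertices with the same image would both be out-neighbours of it and would
    dominate each other by \<open>source\<close>.\<close>
  have "inj_on g (verts G)"
  proof (rule inj_onI, rule ccontr)
    fix b c assume "b \<in> verts G" "c \<in> verts G" "g b = g c" "b \<noteq> c"
    then have "b \<rightarrow> c" "c \<rightarrow> b"
      using source[of b c] source[of c b] g[of b] g[of c] by simp_all
    then show False using no_opposite_arcs by blast
  qed
  moreover have "g ` verts G \<subseteq> verts G"
    using g by (auto dest: adj_in_verts)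
  ultimately have bij: "bij_betw g (verts G) (verts G)"
    by (simp add: bij_betw_def endo_inj_surj)
  \<comment> \<open>\<open>permutes\<close> demands the identity outside the vertex set.\<close>
  define h where "h x = (if x \<in> verts G then g x else x)" for x
  have h: "h permutes verts G"
    using bij by (intro bij_imp_permutes) (auto simp: h_def cong: bij_betw_cong)
  define s where "s = inv h"
  have s: "s permutes verts G"
    unfolding s_def using h by (rule permutes_inv)
  have gs: "g (s x) = x" "s x \<in> verts G" if "x \<in> verts G" for x
  proof -
    show "s x \<in> verts G" using s that by (simp add: permutes_in_image)
    moreover have "h (s x) = x" using permutes_inverses(1)[OF h] by (simp add: s_def)
    ultimately show "g (s x) = x" by (simp add: h_def)
  qed
  show thesis
  proof (rule that[OF s])
    show "x \<rightarrow> s x" if "x \<in> verts G" for x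
      using g[of "s x"] gs[OF that] by simp
    show "s x \<rightarrow> y" if "x \<rightarrow> y" "y \<noteq> s x" for x y
      using source[of "s x" y] gs[of x] adj_in_verts(1)[OF that(1)] that by simp
  qed
qed

lemma orbit_successor_permutation:
  fixes G (structure)
  assumes "fin_digraph G" "strongly_connected G"
    and acyc: "\<And>x. x \<in> verts G \<Longrightarrow> acyclic_digraph (G \<restriction> in_neighbours G x)"
    and perm: "s permutes verts G" and arc: "\<And>x. x \<in> verts G \<Longrightarrow> x \<rightarrow>\<^bsub>G\<^esub> s x"
    and step: "\<And>x y. x \<rightarrow>\<^bsub>G\<^esub> y \<Longrightarrow> y \<noteq> s x \<Longrightarrow> s x \<rightarrow>\<^bsub>G\<^esub> y"
    and v: "v \<in> verts G"
  shows "orbit s v = verts G"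
proof
  interpret fin_digraph G by fact
  have perm': "permutation s"
    using perm finite_verts by (rule permutes_imp_permutation[rotated])
  show sub: "orbit s v \<subseteq> verts G"
    using perm v by (rule permutes_orbit_subset)
  have closed: "p \<in> orbit s v" if "c \<in> orbit s v" "c \<rightarrow> p" for c p
  proof (rule ccontr)
    assume p: "p \<notin> orbit s v"
    let ?R = "arcs_ends (G \<restriction> in_neighbours G p)"
    have orb: "(s ^^ n) c \<in> orbit s v" for n
      using that(1) by (rule funpow_in_orbit)
    \<comment> \<open>As \<open>p\<close> lies off the orbit, it is never the next vertex, so
      \<open>step\<close> carries the arc to \<open>p\<close> along the whole orbit.\<close>
    have dom: "(s ^^ n) c \<rightarrow> p" for n
    proof (induction n)
      case (Suc n)
      then show ?case
        using step[of "(s ^^ n) c" p] orb[of "Suc n"] p by auto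
    qed (simp add: that(2))
    have edge: "((s ^^ n) c, (s ^^ Suc n) c) \<in> ?R" for n
    proof -
      have "(s ^^ n) c \<rightarrow> (s ^^ Suc n) c"
        using orb[of n] sub by (auto intro: arc)
      then show ?thesis
        using dom[of n] dom[of "Suc n"]
        by (simp add: dominates_induce_subgraph_iff in_neighbours_def)
    qed
    have walk: "(c, (s ^^ Suc n) c) \<in> ?R\<^sup>+" for n
    proof (induction n)
      case 0
      show ?case using edge[of 0] by auto
    next
      case (Suc n)
      show ?case by (rule trancl_into_trancl[OF Suc edge])
    qed
    \<comment> \<open>A permutation of finite support returns to \<open>c\<close> after a positive
      number of steps, which closes the walk.\<close>
    obtain n where "c = (s ^^ n) c" "0 < n"
      using permutation_self_in_orbit[OF perm', of c] by (auto simp: orbit_altdef)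
    then have "(c, c) \<in> ?R\<^sup>+"
      using walk[of "n - 1"] by simp
    moreover have "acyclic ?R"
      using acyc[of p] that(2)
      by (auto simp: acyclic_digraph_iff wellformed_induce_subgraph dest: adj_in_verts)
    ultimately show False by (auto simp: acyclic_def)
  qed
  show "verts G \<subseteq> orbit s v"
  proof
    fix w assume "w \<in> verts G"
    then have "v \<rightarrow>\<^sup>* w"
      using assms(2) v by auto
    then show "w \<in> orbit s v"
      by (induction rule: reachable_induct)
        (auto intro: closed permutation_self_in_orbit[OF perm'])
  qed
qed

text \<open>The list runs once through the orbit of \<open>s\<close>. Moving the tail of an arc to
  its successor keeps the head, until the head itself is reached.\<close>

lemma in_roundI_successor_permutation:
  fixes G (structure)
  assumes "wf_digraph G" and orbit: "orbit s v = verts G" "v \<in> orbit s v"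
    and step: "\<And>x y. x \<rightarrow>\<^bsub>G\<^esub> y \<Longrightarrow> y \<noteq> s x \<Longrightarrow> s x \<rightarrow>\<^bsub>G\<^esub> y"
  shows "\<exists>vs. in_round G vs"
proof -
  interpret wf_digraph G by fact
  \<comment> \<open>The least positive return time of \<open>v\<close>, hence the length of the
    cycle.\<close>
  define n where "n = funpow_dist1 s v v"
  define vs where "vs = map (\<lambda>k. (s ^^ k) v) [0..<n]"
  have period: "(s ^^ n) v = v"
    unfolding n_def using orbit(2) by (rule funpow_dist1_prop)
  have dist: "distinct vs"
    using inj_on_funpow_dist1[OF orbit(2)] by (simp add: vs_def n_def distinct_map del: upt_Suc)
  have set_vs: "set vs = verts G"
    using orbit_conv_funpow_dist1[OF orbit(2)] orbit(1) by (simp add: vs_def n_def del: upt_Suc)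
  have "z \<rightarrow> y" if xy: "x \<rightarrow> y" and z: "z \<in> open_cyclic_interval vs x y" for x y z
  proof -
    \<comment> \<open>With the head \<open>y\<close> first, the interval from \<open>x\<close> to
      \<open>y\<close> is just the part of the list after \<open>x\<close>.\<close>
    obtain m where "rotate m vs ! 0 = y"
      using adj_in_verts(2)[OF xy] set_vs rotate_to_front by metis
    moreover define ws where "ws = rotate m vs"
    ultimately have y: "ws ! 0 = y" by simp
    have len: "length ws = n"
      by (simp add: ws_def vs_def)
    have succ: "ws ! Suc k = s (ws ! k)" if "Suc k < n" for k
    proof -
      have "ws ! k = (s ^^ (m + k)) v" if "k < n" for k
        using that
        by (simp add: ws_def nth_rotate vs_def funpow_mod_eq[OF period])
      then show ?thesis using that by simp
    qed
    have dist_ws: "distinct ws" and set_ws: "set ws = verts G"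
      using dist set_vs by (simp_all add: ws_def)
    obtain i where i: "i < n" "x = ws ! i"
      using adj_in_verts(1)[OF xy] set_ws len by (metis in_set_conv_nth)
    have "z \<in> open_cyclic_interval ws (ws ! i) (ws ! 0)"
      using z i y by (simp add: ws_def open_cyclic_interval_rotate)
    then obtain k where k: "i < k" "k < n" "z = ws ! k"
      using i len dist_ws by (subst (asm) open_cyclic_interval_nth) auto
    have "ws ! k \<rightarrow> y"
      using less_imp_le[OF k(1)] k(2)
    proof (induction k rule: dec_induct)
      case (step k)
      \<comment> \<open>The successor is still within the list at a positive position, so it is not
        \<open>y\<close>.\<close>
      have "ws ! Suc k \<noteq> ws ! 0"
        using step.prems dist_ws len by (subst nth_eq_iff_index_eq) auto
      then show ?case
        using step assms(4)[of "ws ! k" y] y succ[of k] by auto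
    qed (use xy i in simp)
    then show ?thesis using k by simp
  qed
  then show ?thesis
    using dist set_vs by (auto simp: in_round_def vertex_ordering_def)
qed

lemma ex_in_round:
  fixes G (structure)
  assumes "oriented_graph G" and conn: "strongly_connected G"
    and tour: "\<And>x. x \<in> verts G \<Longrightarrow> tournament (G \<restriction> out_neighbours G x)"
    and acyc: "\<And>x. x \<in> verts G \<Longrightarrow> acyclic_digraph (G \<restriction> in_neighbours G x)"
  shows "\<exists>vs. in_round G vs"
proof -
  interpret oriented_graph G by fact
  obtain v where v: "v \<in> verts G"
    using conn by (auto simp: strongly_connected_def)
  show ?thesis
  proof (cases "verts G = {v}")
    case True
    then have "in_round G [v]"
      by (auto simp: in_round_def vertex_ordering_def open_cyclic_interval_def)
    then show ?thesis ..
  next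
    case False
    have pred: "\<exists>a. a \<rightarrow> b" if "b \<in> verts G" for b
    proof -
      obtain c where "c \<in> verts G" "c \<noteq> b"
        using False v by blast
      then have "c \<rightarrow>\<^sup>+ b"
        using conn that by auto
      then show ?thesis by (auto elim: tranclE)
    qed
    obtain s where s: "s permutes verts G" "\<And>x. x \<in> verts G \<Longrightarrow> x \<rightarrow> s x"
      "\<And>x y. x \<rightarrow> y \<Longrightarrow> y \<noteq> s x \<Longrightarrow> s x \<rightarrow> y"
      using ex_successor_permutation[OF assms(1) tour acyc pred] by blast
    have "orbit s v = verts G"
      using orbit_successor_permutation[OF fin_digraph_axioms conn acyc s v] .
    then show ?thesis
      using v s(3)
      by (intro in_roundI_successor_permutation[OF wf_digraph_axioms, of s v]) auto
  qed
qed

theorem theorem8p3p1: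
  fixes D :: "('a, 'b) pre_digraph"
  assumes "oriented_graph D"
    and "strongly_connected D"
  shows "(\<forall>x\<in>verts D. tournament (D \<restriction> out_neighbours D x) \<and>
                        acyclic_digraph (D \<restriction> in_neighbours D x))
    \<longleftrightarrow> (\<exists>vs. vertex_ordering D vs \<and>
          (\<forall>x y. x \<rightarrow>\<^bsub>D\<^esub> y \<longrightarrow>
            (\<forall>z\<in>open_cyclic_interval vs x y. z \<rightarrow>\<^bsub>D\<^esub> y)))"
  unfolding in_round_def[symmetric]
  using ex_in_round[OF assms] tournament_out_neighbours[OF assms(1)]
    acyclic_in_neighbours[OF assms(1)]
  by blast

end
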